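(* Consider the fair Wasserstein coreset problem with fixed labels $(\hat D_j,\hat Y_j)_{j\in[m]}$, $$\min_{\theta\in\Delta_m,\ \hat X\in\mathcal X^m}\ \mathcal W_c(p_{\hat Z;\theta},p_{Z;e})\quad\text{s.t.}\quad \left|\frac{p_{\hat Z;\theta}(y\mid d)}{p_{Y_T}(y)}-1\right|\le\epsilon\quad\forall d\in\mathcal D,\ y\in\mathcal Y. \qquad (\mathrm P)$$ Then: (i) for $\theta\in\Delta_m$, the fairness constraints in $(\mathrm P)$ hold if and only if, for all $d\in\mathcal D$, $y\in\mathcal Y$, $$(1-\epsilon)\,p_{Y_T}(y)\sum_{i\in[m]:\hat D_i=d}\theta_i\ \le\ \sum_{i\in[m]:\hat D_i=d,\hat Y_i=y}\theta_i\ \le\ (1+\epsilon)\,p_{Y_T}(y)\sum_{i\in[m]:\hat D_i=d}\theta_i ,$$ i.e. if and only if $A\theta\ge\mathbf 0$, where $A$ is the matrix with $2|\mathcal Y||\mathcal D|$ rows encoding these inequalities; (ii) problem $(\mathrm P)$ is equivalent to $$\min_{\hat X\in\mathcal X^m} F(C(\hat X)),\qquad F(C)=\min\Big\{\langle C,P\rangle:\ P\in\mathbb R^{n\times m},\ P\mathbf 1_m=\tfrac1n\mathbf 1_n,\ P\ge\mathbf 0,\ AP^\top\mathbf 1_n\ge\mathbf 0\Big\},$$ in the sense that both have the same optimal value and, if $\hat X^\star$ is a minimizer of $F(C(\cdot))$ over $\mathcal X^m$ and $P^\star$ is a minimizer of the linear program defining $F(C(\hat X^\star))$, then $(\theta^\star,\hat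 X^\star)$ with $\theta^\star=m\,(P^\star)^\top\mathbf 1_n$ is an optimal solution of $(\mathrm P)$.
   Context: $\mathcal Z=\mathcal D\times\mathcal X\times\mathcal Y\subseteq\mathbb R^d$ with $\mathcal D,\mathcal Y$ finite. The data are $Z_i=(D_i,X_i,Y_i)\in\mathcal Z$, $i\in[n]$. The coreset points are $\hat Z_j=(\hat D_j,\hat X_j,\hat Y_j)$, $j\in[m]$, where $\hat D_j\in\mathcal D$, $\hat Y_j\in\mathcal Y$ are fixed in advance and $\hat X=(\hat X_1,\dots,\hat X_m)\in\mathcal X^m$ is variable. $\Delta_m=\{\theta\in\mathbb R^m_+:\sum_{j}\theta_j=m\}$. $p_{\hat Z;\theta}=\frac1m\sum_{j=1}^m\theta_j\delta_{\hat Z_j}$ and $p_{Z;e}=\frac1n\sum_{i=1}^n\delta_{Z_i}$. $p_{\hat Z;\theta}(y\mid d)$ is the conditional probability of $\hat Y=y$ given $\hat D=d$ under $p_{\hat Z;\theta}$; a constraint involving a $d$ with $\sum_{i:\hat D_i=d}\theta_i=0$ is regarded as satisfied. $p_{Y_T}$ is a given target probability distribution on $\mathcal Y$ with $p_{Y_T}(y)>0$ for all $y$, and $\epsilon\ge0$ is given. $c:\mathcal Z\times\mathcal Z\to[0,\infty)$ is a (symmetric) transportation cost and $\mathcal W_c(p_1,p_2)=\min_{\pi}\int c\,d\pi$ over couplings $\pi$ of $p_1,p_2$. The cost matrix $C(\hat X)\in\mathbb R^{n\times m}$ has entries $C(\hat X)_{ij}=c(Z_i,\hat Z_j)$. $\langle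 C,P\rangle=\sum_{ij}C_{ij}P_{ij}$, $\mathbf 1_k$ is the all-ones vector in $\mathbb R^k$, and inequalities between vectors/matrices are entrywise. A minimum over an empty set is $+\infty$. *)

theory Defs
  imports "HOL-Probability.Probability"
begin

text \<open>
  The index sets of the data points and of the coreset points are finite types \<open>'n\<close> and \<open>'m\<close>, so
  that \<open>n\<close> is \<open>CARD('n)\<close>, \<open>m\<close> is \<open>CARD('m)\<close> and an \<open>n \<times> m\<close> matrix is of type \<open>real^'m^'n\<close>.
  On this type, \<open>\<bullet>\<close> is the entrywise (Frobenius) inner product, \<open>\<le>\<close> is entrywise, and the vector
  \<open>1\<close> is the all-ones vector. A point of \<open>\<Z> = \<D> \<times> \<X> \<times> \<Y>\<close> is a triple, and the product type
  of three Euclidean spaces is again a Euclidean space.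
\<close>

text \<open>
  The discrete measure \<open>(1/k) \<Sum>\<^sub>j \<theta>\<^sub>j \<delta>(z\<^sub>j)\<close> on the set \<open>S\<close> (with its trace Borel sigma-algebra),
  where \<open>k = CARD('k)\<close>: the image under \<open>z\<close> of the measure giving mass \<open>\<theta>\<^sub>j/k\<close> to the index \<open>j\<close>.
\<close>

definition weighted_empirical ::
  "'z::topological_space set \<Rightarrow> real^'k \<Rightarrow> ('k::finite \<Rightarrow> 'z) \<Rightarrow> 'z measure" where
  "weighted_empirical S \<theta> z =
     distr (point_measure UNIV (\<lambda>j. ennreal (\<theta> $ j / real CARD('k)))) (restrict_space borel S) z"

lemma emeasure_weighted_empirical:
  fixes z :: "'k::finite \<Rightarrow> 'z::topological_space"
  assumes "range z \<subseteq> S" and "B \<in> sets (restrict_space borel S)"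
  shows "emeasure (weighted_empirical S \<theta> z) B =
    (\<Sum>j\<in>UNIV. ennreal (\<theta> $ j / real CARD('k)) * indicator B (z j))"
proof -
  have m: "z \<in> measurable (point_measure UNIV (\<lambda>j. ennreal (\<theta> $ j / real CARD('k))))
      (restrict_space borel S)"
    using assms(1) by (auto simp: measurable_def space_restrict_space space_point_measure sets_point_measure)
  show ?thesis
    unfolding weighted_empirical_def
    using assms(2)
    by (subst emeasure_distr[OF m])
      (auto simp: space_point_measure emeasure_point_measure_finite indicator_def of_bool_def
        if_distrib[of "(*) _"] sum.If_cases vimage_def cong: if_cong)
qed

definition weight_simplex :: "(real^'m::finite) set" where
  "weight_simplex = {\<theta>. 0 \<le> \<theta> \<and> (\<Sum>j\<in>UNIV. \<theta> $ j) = real CARD('m)}"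

definition couplings :: "'a measure \<Rightarrow> 'b measure \<Rightarrow> ('a \<times> 'b) measure set" where
  "couplings p q =
     {\<pi>. sets \<pi> = sets (p \<Otimes>\<^sub>M q) \<and> distr \<pi> p fst = p \<and> distr \<pi> q snd = q}"

text \<open>
  For finitely supported marginals whose singletons are measurable, every coupling is finitely
  supported, so the integral below is a finite sum and no measurability of \<open>c\<close> is needed.
\<close>

definition wasserstein :: "('a \<Rightarrow> 'a \<Rightarrow> real) \<Rightarrow> 'a measure \<Rightarrow> 'a measure \<Rightarrow> ennreal" where
  "wasserstein c p q = (INF \<pi>\<in>couplings p q. \<integral>\<^sup>+ z. ennreal (c (fst z) (snd z)) \<partial>\<pi>)"

definition coreset_point ::
  "('m \<Rightarrow> 'd) \<Rightarrow> ('m \<Rightarrow> 'y) \<Rightarrow> ('m \<Rightarrow> 'x) \<Rightarrow> 'm \<Rightarrow> 'd \<times> 'x \<times> 'y" where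
  "coreset_point Dh Yh Xh j = (Dh j, Xh j, Yh j)"

text \<open>
  The conditional probability \<open>p(y | d)\<close>; if \<open>d\<close> has probability zero then the value is \<open>0\<close>.
\<close>

definition label_cond_prob :: "('d \<times> 'x \<times> 'y) measure \<Rightarrow> 'y \<Rightarrow> 'd \<Rightarrow> real" where
  "label_cond_prob p y d = cond_prob p (\<lambda>(d', x', y'). y' = y) (\<lambda>(d', x', y'). d' = d)"

text \<open>
  Constraints for those \<open>d\<close> which carry no coreset weight are regarded as satisfied.
\<close>

definition fairness_constraints ::
  "'d::euclidean_space set \<Rightarrow> 'x::euclidean_space set \<Rightarrow> 'y::euclidean_space set \<Rightarrow> 'y pmf \<Rightarrow> real
   \<Rightarrow> ('m::finite \<Rightarrow> 'd) \<Rightarrow> ('m \<Rightarrow> 'y) \<Rightarrow> real^'m \<Rightarrow> ('m \<Rightarrow> 'x) \<Rightarrow> bool" where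
  "fairness_constraints \<D> \<X> \<Y> pT \<epsilon> Dh Yh \<theta> Xh \<longleftrightarrow>
     (\<forall>d\<in>\<D>. \<forall>y\<in>\<Y>. (\<Sum>i | Dh i = d. \<theta> $ i) = 0 \<or>
        \<bar>label_cond_prob (weighted_empirical (\<D> \<times> \<X> \<times> \<Y>) \<theta> (coreset_point Dh Yh Xh)) y d
           / pmf pT y - 1\<bar> \<le> \<epsilon>)"

definition coreset_feasible ::
  "'d::euclidean_space set \<Rightarrow> 'x::euclidean_space set \<Rightarrow> 'y::euclidean_space set \<Rightarrow> 'y pmf \<Rightarrow> real
   \<Rightarrow> ('m::finite \<Rightarrow> 'd) \<Rightarrow> ('m \<Rightarrow> 'y) \<Rightarrow> ((real^'m) \<times> ('m \<Rightarrow> 'x)) set" where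
  "coreset_feasible \<D> \<X> \<Y> pT \<epsilon> Dh Yh =
     {(\<theta>, Xh). \<theta> \<in> weight_simplex \<and> range Xh \<subseteq> \<X> \<and>
        fairness_constraints \<D> \<X> \<Y> pT \<epsilon> Dh Yh \<theta> Xh}"

definition coreset_objective ::
  "'d::euclidean_space set \<Rightarrow> 'x::euclidean_space set \<Rightarrow> 'y::euclidean_space set
   \<Rightarrow> ('d \<times> 'x \<times> 'y \<Rightarrow> 'd \<times> 'x \<times> 'y \<Rightarrow> real) \<Rightarrow> ('n::finite \<Rightarrow> 'd \<times> 'x \<times> 'y)
   \<Rightarrow> ('m::finite \<Rightarrow> 'd) \<Rightarrow> ('m \<Rightarrow> 'y) \<Rightarrow> (real^'m) \<times> ('m \<Rightarrow> 'x) \<Rightarrow> ereal" where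
  "coreset_objective \<D> \<X> \<Y> c Z Dh Yh = (\<lambda>(\<theta>, Xh).
     enn2ereal (wasserstein c
       (weighted_empirical (\<D> \<times> \<X> \<times> \<Y>) \<theta> (coreset_point Dh Yh Xh))
       (weighted_empirical (\<D> \<times> \<X> \<times> \<Y>) 1 Z)))"

text \<open>
  The matrix \<open>A\<close> is given by its rows, indexed by \<open>\<D> \<times> \<Y> \<times> {True, False}\<close>: \<open>True\<close> marks the
  lower and \<open>False\<close> the upper inequality for \<open>(d, y)\<close>. The component of \<open>A \<theta>\<close> at a row index \<open>r\<close>
  is \<open>A r \<bullet> \<theta>\<close>.
\<close>

definition fairness_rows :: "'d set \<Rightarrow> 'y set \<Rightarrow> ('d \<times> 'y \<times> bool) set" where
  "fairness_rows \<D> \<Y> = \<D> \<times> \<Y> \<times> UNIV"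

fun fairness_matrix ::
  "'y pmf \<Rightarrow> real \<Rightarrow> ('m::finite \<Rightarrow> 'd) \<Rightarrow> ('m \<Rightarrow> 'y) \<Rightarrow> 'd \<times> 'y \<times> bool \<Rightarrow> real^'m" where
  "fairness_matrix pT \<epsilon> Dh Yh (d, y, True) =
     (\<chi> j. of_bool (Dh j = d \<and> Yh j = y) - (1 - \<epsilon>) * pmf pT y * of_bool (Dh j = d))"
| "fairness_matrix pT \<epsilon> Dh Yh (d, y, False) =
     (\<chi> j. (1 + \<epsilon>) * pmf pT y * of_bool (Dh j = d) - of_bool (Dh j = d \<and> Yh j = y))"

definition cost_matrix ::
  "('z \<Rightarrow> 'z \<Rightarrow> real) \<Rightarrow> ('n::finite \<Rightarrow> 'z) \<Rightarrow> ('m::finite \<Rightarrow> 'z) \<Rightarrow> real^'m^'n" where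
  "cost_matrix c z zh = (\<chi> i j. c (z i) (zh j))"

text \<open>
  \<open>lp_value\<close> is the function \<open>F\<close>; the infimum over the empty set is \<open>\<infinity>\<close>.
\<close>

definition lp_feasible :: "'r set \<Rightarrow> ('r \<Rightarrow> real^'m) \<Rightarrow> (real^'m::finite^'n::finite) set" where
  "lp_feasible R A =
     {P. P *v 1 = (1 / real CARD('n)) *\<^sub>R 1 \<and> 0 \<le> P \<and> (\<forall>r\<in>R. 0 \<le> A r \<bullet> (transpose P *v 1))}"

definition lp_value :: "'r set \<Rightarrow> ('r \<Rightarrow> real^'m) \<Rightarrow> real^'m::finite^'n::finite \<Rightarrow> ereal" where
  "lp_value R A C = (INF P\<in>lp_feasible R A. ereal (C \<bullet> P))"

end

theory Submission
  imports Defs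
begin

text \<open>
  For fixed coreset points, eliminating \<open>\<theta> = m P\<^sup>T 1\<close> merges the optimal transport problem and the
  minimisation over the weights into one linear program, provided that couplings of the two
  discrete measures correspond to transport matrices with the same cost. A matrix \<open>P\<close> gives a
  coupling by pushing forward along \<open>(i, j) \<mapsto> (z j, w i)\<close>. The converse has to allow for coinciding
  points: with functions \<open>f j\<close> and \<open>g i\<close> vanishing off \<open>z j\<close> and \<open>w i\<close>, each family summing to \<open>1\<close>
  almost everywhere and having the point weights as integrals, a coupling \<open>\<pi>\<close> gives the matrix
  \<open>P i j = \<integral> f j(x) g i(y) d\<pi>(x, y)\<close>.
\<close>

section \<open>Weighted discrete measures on the trace Borel sigma-algebra\<close>

lemma measurable_point_measure_UNIV:
  fixes z :: "'k \<Rightarrow> 'z::topological_space"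
  assumes "range z \<subseteq> S"
  shows "z \<in> measurable (point_measure UNIV w) (restrict_space borel S)"
  using assms by (auto simp: measurable_def space_restrict_space space_point_measure sets_point_measure)

lemma space_weighted_empirical [simp]: "space (weighted_empirical S \<theta> z) = S"
  by (simp add: weighted_empirical_def space_restrict_space)

lemma sets_weighted_empirical [simp, measurable_cong]:
  "sets (weighted_empirical S \<theta> z) = sets (restrict_space borel S)"
  by (simp add: weighted_empirical_def)

text \<open>Since \<open>ennreal\<close> truncates negative numbers to 0, it is the nonnegativity of
  \<open>\<theta>\<close> that turns the extended sum into a sum of the real weights.\<close>

lemma measure_weighted_empirical:
  fixes z :: "'k::finite \<Rightarrow> 'z::topological_space"
  assumes "range z \<subseteq> S" and "B \<in> sets (restrict_space borel S)" and "0 \<le> \<theta>"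
  shows "measure (weighted_empirical S \<theta> z) B = (\<Sum>j | z j \<in> B. \<theta> $ j) / real CARD('k)"
proof -
  have nn: "0 \<le> \<theta> $ j" for j
    using assms(3) by (simp add: less_eq_vec_def)
  have "emeasure (weighted_empirical S \<theta> z) B =
      (\<Sum>j\<in>UNIV. ennreal (\<theta> $ j / real CARD('k) * indicator B (z j)))"
    by (subst emeasure_weighted_empirical[OF assms(1,2)]) (rule sum.cong, auto simp: indicator_def)
  also have "\<dots> = ennreal (\<Sum>j\<in>UNIV. \<theta> $ j / real CARD('k) * indicator B (z j))"
    using nn by (intro sum_ennreal) auto
  also have "(\<Sum>j\<in>UNIV. \<theta> $ j / real CARD('k) * indicator B (z j)) =
      (\<Sum>j | z j \<in> B. \<theta> $ j) / real CARD('k)"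
    by (auto simp: sum_divide_distrib indicator_def intro!: sum.mono_neutral_cong_right)
  finally show ?thesis
    using nn by (simp add: measure_def sum_nonneg)
qed

section \<open>Fairness constraints as linear inequalities\<close>

text \<open>The factor \<open>1 / CARD('m)\<close> cancels between the joint and the marginal mass.
  If no weight sits at \<open>d\<close>, both sides are 0 by the convention for division.\<close>

lemma label_cond_prob_weighted_empirical:
  fixes Dh :: "'m::finite \<Rightarrow> 'd::euclidean_space" and Yh :: "'m \<Rightarrow> 'y::euclidean_space"
    and Xh :: "'m \<Rightarrow> 'x::euclidean_space"
  assumes "range (coreset_point Dh Yh Xh) \<subseteq> S" and "0 \<le> \<theta>"
  shows "label_cond_prob (weighted_empirical S \<theta> (coreset_point Dh Yh Xh)) y d =
    (\<Sum>i | Dh i = d \<and> Yh i = y. \<theta> $ i) / (\<Sum>i | Dh i = d. \<theta> $ i)"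
proof -
  \<comment> \<open>Level sets of the continuous projections are closed, hence Borel; their traces
    on \<open>S\<close> are the events inside \<open>cond_prob\<close>.\<close>
  have D: "{z :: 'd \<times> 'x \<times> 'y. fst z = d} \<in> sets borel"
    by (intro borel_closed closed_Collect_eq continuous_intros)
  have Y: "{z :: 'd \<times> 'x \<times> 'y. snd (snd z) = y} \<in> sets borel"
    by (intro borel_closed closed_Collect_eq continuous_intros)
  have 1: "{z \<in> S. fst z = d} \<in> sets (restrict_space borel S)"
    using D by (auto simp: sets_restrict_space intro!: image_eqI[where x = "{z. fst z = d}"])
  have 2: "{z \<in> S. snd (snd z) = y \<and> fst z = d} \<in> sets (restrict_space borel S)"
    using sets.Int[OF D Y]
    by (auto simp: sets_restrict_space
        intro!: image_eqI[where x = "{z. fst z = d} \<inter> {z. snd (snd z) = y}"])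
  have c: "(Dh j, Xh j, Yh j) \<in> S" for j
    using assms(1) by (auto simp: coreset_point_def)
  show ?thesis
    unfolding label_cond_prob_def cond_prob_def
    by (simp add: case_prod_unfold measure_weighted_empirical[OF assms(1) 1 assms(2)]
        measure_weighted_empirical[OF assms(1) 2 assms(2)])
       (simp add: coreset_point_def c conj_commute)
qed

text \<open>Multiplying by the positive number \<open>pmf pT y\<close> times the weight at
  \<open>d\<close> clears both denominators. If that weight is 0, the inequalities must hold
  automatically to match the convention for empty groups.\<close>

lemma fairness_constraints_iff:
  fixes Dh :: "'m::finite \<Rightarrow> 'd::euclidean_space" and Yh :: "'m \<Rightarrow> 'y::euclidean_space"
    and Xh :: "'m \<Rightarrow> 'x::euclidean_space"
  assumes "range (coreset_point Dh Yh Xh) \<subseteq> \<D> \<times> \<X> \<times> \<Y>" and "0 \<le> \<theta>"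
    and pos: "\<And>y. y \<in> \<Y> \<Longrightarrow> 0 < pmf pT y"
  shows "fairness_constraints \<D> \<X> \<Y> pT \<epsilon> Dh Yh \<theta> Xh \<longleftrightarrow>
    (\<forall>d\<in>\<D>. \<forall>y\<in>\<Y>.
       (1 - \<epsilon>) * pmf pT y * (\<Sum>i | Dh i = d. \<theta> $ i) \<le> (\<Sum>i | Dh i = d \<and> Yh i = y. \<theta> $ i) \<and>
       (\<Sum>i | Dh i = d \<and> Yh i = y. \<theta> $ i) \<le> (1 + \<epsilon>) * pmf pT y * (\<Sum>i | Dh i = d. \<theta> $ i))"
proof -
  have nn: "0 \<le> \<theta> $ j" for j
    using assms(2) by (simp add: less_eq_vec_def)
  have eq: "((\<Sum>i | Dh i = d. \<theta> $ i) = 0 \<or>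
      \<bar>(\<Sum>i | Dh i = d \<and> Yh i = y. \<theta> $ i) / (\<Sum>i | Dh i = d. \<theta> $ i) / pmf pT y - 1\<bar> \<le> \<epsilon>) \<longleftrightarrow>
      (1 - \<epsilon>) * pmf pT y * (\<Sum>i | Dh i = d. \<theta> $ i) \<le> (\<Sum>i | Dh i = d \<and> Yh i = y. \<theta> $ i) \<and>
      (\<Sum>i | Dh i = d \<and> Yh i = y. \<theta> $ i) \<le> (1 + \<epsilon>) * pmf pT y * (\<Sum>i | Dh i = d. \<theta> $ i)"
    (is "(?s = 0 \<or> \<bar>?t / ?s / _ - 1\<bar> \<le> \<epsilon>) \<longleftrightarrow> _")
    if "y \<in> \<Y>" for d y
  proof (cases "?s = 0")
    case True
    \<comment> \<open>The points with label \<open>y\<close> are a subfamily of those at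
      \<open>d\<close>, so \<open>?s = 0\<close> forces \<open>?t = 0\<close> and both inequalities
      become \<open>0 \<le> 0\<close>.\<close>
    have "?t \<le> ?s" "0 \<le> ?t"
      using nn by (auto intro!: sum_mono2 sum_nonneg)
    then show ?thesis
      using True by simp
  next
    case False
    have "0 \<le> ?s"
      using nn by (auto intro!: sum_nonneg)
    with False pos[OF that] have "0 < pmf pT y * ?s" and "pmf pT y \<noteq> 0"
      by auto
    from pos_divide_le_eq[OF this(1), of ?t "1 + \<epsilon>"] pos_le_divide_eq[OF this(1), of "1 - \<epsilon>" ?t]
    have "\<bar>?t / (pmf pT y * ?s) - 1\<bar> \<le> \<epsilon> \<longleftrightarrow>
        (1 - \<epsilon>) * (pmf pT y * ?s) \<le> ?t \<and> ?t \<le> (1 + \<epsilon>) * (pmf pT y * ?s)"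
      by (auto simp: abs_le_iff)
    then show ?thesis
      using False by (simp add: mult_ac)
  qed
  show ?thesis
    unfolding fairness_constraints_def label_cond_prob_weighted_empirical[OF assms(1,2)]
    using eq by simp
qed

text \<open>Each entry of \<open>A \<theta>\<close> is the slack of one inequality, so its sign
  decides that inequality.\<close>

lemma fairness_matrix_inner:
  "fairness_matrix pT \<epsilon> Dh Yh (d, y, True) \<bullet> \<theta> =
     (\<Sum>i | Dh i = d \<and> Yh i = y. \<theta> $ i) - (1 - \<epsilon>) * pmf pT y * (\<Sum>i | Dh i = d. \<theta> $ i)"
  "fairness_matrix pT \<epsilon> Dh Yh (d, y, False) \<bullet> \<theta> =
     (1 + \<epsilon>) * pmf pT y * (\<Sum>i | Dh i = d. \<theta> $ i) - (\<Sum>i | Dh i = d \<and> Yh i = y. \<theta> $ i)"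
proof -
  \<comment> \<open>Used from right to left: once all filtered sums are indicator sums over the
    whole type, only linearity remains.\<close>
  have s: "(\<Sum>i\<in>UNIV. of_bool (Q i) * \<theta> $ i) = (\<Sum>i | Q i. \<theta> $ i)" for Q
    by (simp add: of_bool_def if_distrib[of "\<lambda>x. x * _"] sum.If_cases cong: if_cong)
  show "fairness_matrix pT \<epsilon> Dh Yh (d, y, True) \<bullet> \<theta> =
     (\<Sum>i | Dh i = d \<and> Yh i = y. \<theta> $ i) - (1 - \<epsilon>) * pmf pT y * (\<Sum>i | Dh i = d. \<theta> $ i)"
    by (simp only: s[symmetric] fairness_matrix.simps inner_vec_def vec_lambda_beta inner_real_def
        left_diff_distrib sum_subtractf sum_distrib_left mult.assoc)
  show "fairness_matrix pT \<epsilon> Dh Yh (d, y, False) \<bullet> \<theta> =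
     (1 + \<epsilon>) * pmf pT y * (\<Sum>i | Dh i = d. \<theta> $ i) - (\<Sum>i | Dh i = d \<and> Yh i = y. \<theta> $ i)"
    by (simp only: s[symmetric] fairness_matrix.simps inner_vec_def vec_lambda_beta inner_real_def
        left_diff_distrib sum_subtractf sum_distrib_left mult.assoc)
qed

lemma fairness_rows_nonneg_iff:
  "(\<forall>r\<in>fairness_rows \<D> \<Y>. 0 \<le> fairness_matrix pT \<epsilon> Dh Yh r \<bullet> \<theta>) \<longleftrightarrow>
    (\<forall>d\<in>\<D>. \<forall>y\<in>\<Y>.
       (1 - \<epsilon>) * pmf pT y * (\<Sum>i | Dh i = d. \<theta> $ i) \<le> (\<Sum>i | Dh i = d \<and> Yh i = y. \<theta> $ i) \<and>
       (\<Sum>i | Dh i = d \<and> Yh i = y. \<theta> $ i) \<le> (1 + \<epsilon>) * pmf pT y * (\<Sum>i | Dh i = d. \<theta> $ i))"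
  \<comment> \<open>The \<open>bool\<close> component of a row splits into its two values. The
    defining equations are deleted so that rows stay folded until
    \<open>fairness_matrix_inner\<close> applies.\<close>
  by (simp add: fairness_rows_def fairness_matrix_inner all_bool_eq conj_commute
      del: fairness_matrix.simps)

lemma card_fairness_rows: "card (fairness_rows \<D> \<Y>) = 2 * card \<Y> * card \<D>"
  by (simp add: fairness_rows_def card_cartesian_product)

section \<open>From transport matrices to couplings\<close>

lemma transport_plan_cost:
  fixes P :: "real^'m::finite^'n::finite"
  shows "C \<bullet> P = (\<Sum>i\<in>UNIV. \<Sum>j\<in>UNIV. C $ i $ j * P $ i $ j)"
  by (simp add: inner_vec_def)

text \<open>One coupling of the right cost bounds the infimum. Matrix rows belong to
  \<open>w\<close>, the second marginal, and columns to \<open>z\<close>, the first, so column sums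
  give \<open>\<theta>\<close> and row sums give \<open>\<eta>\<close>.\<close>

lemma wasserstein_le_transport_plan:
  fixes z :: "'m::finite \<Rightarrow> 'z::topological_space" and w :: "'n::finite \<Rightarrow> 'z"
    and P :: "real^'m^'n"
  assumes z: "range z \<subseteq> S" and w: "range w \<subseteq> S" and P: "0 \<le> P"
    and rows: "P *v 1 = (1 / real CARD('n)) *\<^sub>R \<eta>"
    and cols: "transpose P *v 1 = (1 / real CARD('m)) *\<^sub>R \<theta>"
    and singletons: "\<And>x. x \<in> S \<Longrightarrow> {x} \<in> sets (restrict_space borel S)"
    and c: "\<And>x y. x \<in> S \<Longrightarrow> y \<in> S \<Longrightarrow> 0 \<le> c x y"
  shows "wasserstein c (weighted_empirical S \<theta> z) (weighted_empirical S \<eta> w) \<le>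
    ennreal ((\<chi> i j. c (z j) (w i)) \<bullet> P)"
proof -
  define p q where "p = weighted_empirical S \<theta> z" and "q = weighted_empirical S \<eta> w"
  define M where "M = point_measure UNIV (\<lambda>(i, j). ennreal (P $ i $ j))"
  define f where "f = (\<lambda>(i, j). (z j, w i))"
  have sets: "sets p = sets (restrict_space borel S)" "sets q = sets (restrict_space borel S)"
    and space: "space p = S" "space q = S"
    by (simp_all add: p_def q_def)
  have nn: "0 \<le> P $ i $ j" for i j
    using P by (simp add: less_eq_vec_def)
  have zS: "z j \<in> S" and wS: "w i \<in> S" for i j
    using z w by auto
  have f: "f \<in> measurable M (p \<Otimes>\<^sub>M q)"
    using zS wS by (auto simp: measurable_def M_def f_def space_point_measure sets_point_measure
        space_pair_measure space)
  have row: "(\<Sum>j\<in>UNIV. P $ i $ j) = \<eta> $ i / real CARD('n)" for i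
    using arg_cong[OF rows, of "\<lambda>v. v $ i"] by (simp add: matrix_vector_mult_def)
  have col: "(\<Sum>i\<in>UNIV. P $ i $ j) = \<theta> $ j / real CARD('m)" for j
    using arg_cong[OF cols, of "\<lambda>v. v $ j"] by (simp add: matrix_vector_mult_def transpose_def)
  have em: "emeasure M B = (\<Sum>i\<in>UNIV. \<Sum>j\<in>UNIV. ennreal (P $ i $ j) * indicator B (i, j))" for B
  proof -
    have "emeasure M B = (\<integral>\<^sup>+x. indicator B x \<partial>M)"
      by (rule nn_integral_indicator[symmetric]) (simp add: M_def sets_point_measure)
    also have "\<dots> = (\<Sum>x\<in>UNIV. ennreal (P $ fst x $ snd x) * indicator B x)"
      unfolding M_def by (subst nn_integral_point_measure_finite) (auto simp: case_prod_unfold)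
    finally show ?thesis
      by (simp only: sum.cartesian_product UNIV_Times_UNIV case_prod_unfold prod.collapse)
  qed
  define \<pi> where "\<pi> = distr M (p \<Otimes>\<^sub>M q) f"
  have dfst: "distr \<pi> p fst = distr M p (\<lambda>(i, j). z j)"
    unfolding \<pi>_def by (subst distr_distr[OF measurable_fst f]) (simp add: f_def comp_def case_prod_unfold)
  have dsnd: "distr \<pi> q snd = distr M q (\<lambda>(i, j). w i)"
    unfolding \<pi>_def by (subst distr_distr[OF measurable_snd f]) (simp add: f_def comp_def case_prod_unfold)
  have "distr \<pi> p fst = p"
  proof (rule measure_eqI)
    fix B assume "B \<in> sets (distr \<pi> p fst)"
    then have B: "B \<in> sets p"
      by simp
    then have "emeasure (distr \<pi> p fst) B = emeasure M ((\<lambda>(i, j). z j) -` B)"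
      unfolding dfst
      by (subst emeasure_distr) (auto simp: measurable_def M_def space_point_measure
          sets_point_measure space zS wS)
    \<comment> \<open>With \<open>i\<close> summed innermost the indicator is a constant factor,
      which leaves a column sum of \<open>P\<close>.\<close>
    also have "\<dots> = (\<Sum>j\<in>UNIV. \<Sum>i\<in>UNIV. ennreal (P $ i $ j) * indicator B (z j))"
      by (subst sum.swap) (simp add: em indicator_def)
    also have "\<dots> = (\<Sum>j\<in>UNIV. ennreal (\<theta> $ j / real CARD('m)) * indicator B (z j))"
      by (simp add: nn flip: col sum_distrib_right sum_ennreal)
    also have "\<dots> = emeasure p B"
      using B z by (simp add: p_def emeasure_weighted_empirical)
    finally show "emeasure (distr \<pi> p fst) B = emeasure p B" .
  qed simp
  moreover have "distr \<pi> q snd = q"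
  proof (rule measure_eqI)
    fix B assume "B \<in> sets (distr \<pi> q snd)"
    then have B: "B \<in> sets q"
      by simp
    then have "emeasure (distr \<pi> q snd) B = emeasure M ((\<lambda>(i, j). w i) -` B)"
      unfolding dsnd
      by (subst emeasure_distr) (auto simp: measurable_def M_def space_point_measure
          sets_point_measure space zS wS)
    also have "\<dots> = (\<Sum>i\<in>UNIV. \<Sum>j\<in>UNIV. ennreal (P $ i $ j) * indicator B (w i))"
      by (simp add: em indicator_def)
    also have "\<dots> = (\<Sum>i\<in>UNIV. ennreal (\<eta> $ i / real CARD('n)) * indicator B (w i))"
      by (simp add: nn flip: row sum_distrib_right sum_ennreal)
    also have "\<dots> = emeasure q B"
      using B w by (simp add: q_def emeasure_weighted_empirical)
    finally show "emeasure (distr \<pi> q snd) B = emeasure q B" .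
  qed simp
  ultimately have coupling: "\<pi> \<in> couplings p q"
    by (simp add: couplings_def \<pi>_def)
  \<comment> \<open>Measurable singletons make the finite set \<open>range f\<close> measurable, so
    that concentration of \<open>\<pi>\<close> on it can be pulled back to \<open>M\<close>.\<close>
  have sing: "{x} \<in> sets (p \<Otimes>\<^sub>M q)" if "x \<in> range f" for x
  proof -
    from that obtain i j where x: "x = (z j, w i)"
      by (auto simp: f_def)
    have "{z j} \<times> {w i} \<in> sets (p \<Otimes>\<^sub>M q)"
      using singletons zS wS by (intro pair_measureI) (auto simp: sets)
    then show ?thesis
      by (simp add: x)
  qed
  then have "(\<Union>x\<in>range f. {x}) \<in> sets (p \<Otimes>\<^sub>M q)"
    by (intro sets.finite_UN) auto
  then have rf: "range f \<in> sets (p \<Otimes>\<^sub>M q)"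
    by simp
  \<comment> \<open>The change of variables for \<open>distr\<close> asks for a measurable
    integrand, which \<open>c\<close> is not assumed to be. \<open>F\<close> is a finite combination
    of indicators of singletons and agrees with the cost on \<open>range f\<close>, which carries
    \<open>\<pi>\<close>.\<close>
  define F where "F x = (\<Sum>y\<in>range f. ennreal (c (fst y) (snd y)) * indicator {y} x)" for x
  have F: "F x = ennreal (c (fst x) (snd x))" if "x \<in> range f" for x
    using that by (simp add: F_def indicator_def if_distrib[of "(*) _"] cong: if_cong)
  have Fm: "F \<in> borel_measurable (p \<Otimes>\<^sub>M q)"
    unfolding F_def using sing by measurable
  have "wasserstein c p q \<le> (\<integral>\<^sup>+x. ennreal (c (fst x) (snd x)) \<partial>\<pi>)"
    unfolding wasserstein_def using coupling by (rule INF_lower)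
  also have "\<dots> = (\<integral>\<^sup>+x. F x \<partial>\<pi>)"
  proof (rule nn_integral_cong_AE)
    have "AE x in \<pi>. x \<in> range f"
      unfolding \<pi>_def using f rf by (subst AE_distr_iff) auto
    then show "AE x in \<pi>. ennreal (c (fst x) (snd x)) = F x"
      by eventually_elim (simp add: F)
  qed
  also have "\<dots> = (\<integral>\<^sup>+x. ennreal (c (fst (f x)) (snd (f x))) \<partial>M)"
    unfolding \<pi>_def by (subst nn_integral_distr[OF f]) (auto simp: F Fm)
  also have "\<dots> = (\<Sum>i\<in>UNIV. \<Sum>j\<in>UNIV. ennreal (P $ i $ j) * ennreal (c (z j) (w i)))"
    by (simp add: M_def nn_integral_point_measure_finite sum.cartesian_product case_prod_unfold f_def)
  also have "\<dots> = ennreal ((\<chi> i j. c (z j) (w i)) \<bullet> P)"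
    using c zS wS nn
    by (simp add: transport_plan_cost sum_nonneg mult.commute flip: ennreal_mult sum_ennreal)
  finally show ?thesis
    by (simp add: p_def q_def)
qed

section \<open>From couplings to transport matrices\<close>

text \<open>The image measure forgets which of several coinciding points a mass came from.
  Integration against \<open>f j\<close> recovers the share of index \<open>j\<close>.\<close>

lemma weighted_empirical_partition_of_unity:
  fixes z :: "'k::finite \<Rightarrow> 'z::topological_space"
  assumes z: "range z \<subseteq> S"
    and singletons: "\<And>x. x \<in> S \<Longrightarrow> {x} \<in> sets (restrict_space borel S)"
  shows "\<exists>f. (\<forall>j. f j \<in> borel_measurable (weighted_empirical S \<theta> z)) \<and>
    (\<forall>j x. x \<noteq> z j \<longrightarrow> f j x = 0) \<and>
    (AE x in weighted_empirical S \<theta> z. (\<Sum>j\<in>UNIV. f j x) = 1) \<and>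
    (\<forall>j. (\<integral>\<^sup>+x. f j x \<partial>weighted_empirical S \<theta> z) = ennreal (\<theta> $ j / real CARD('k)))"
proof -
  define p where "p = weighted_empirical S \<theta> z"
  define u where "u j = ennreal (\<theta> $ j / real CARD('k))" for j
  \<comment> \<open>Several points \<open>z j\<close> may coincide; then their common atom is shared in proportion to the
    weights. If the atom has mass zero, so does \<open>u j\<close>, and the quotient \<open>0 / 0\<close> is \<open>0\<close>.\<close>
  define f where "f j x = u j / emeasure p {z j} * indicator {z j} x" for j x
  have sz: "{z j} \<in> sets p" for j
    using z singletons by (auto simp: p_def)
  have mass: "emeasure p {z j} = (\<Sum>i\<in>UNIV. u i * indicator {z j} (z i))" for j
    using emeasure_weighted_empirical[OF z, of "{z j}"] sz by (simp add: p_def u_def)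
  have fin: "emeasure p {z j} < top" for j
    unfolding mass by (auto simp: u_def indicator_def ennreal_mult_less_top)
  \<comment> \<open>An atom carries at least the mass of each index located there; hence
    \<open>u j \<noteq> 0\<close> makes the denominator nonzero.\<close>
  have le: "u j \<le> emeasure p {z j}" for j
  proof -
    have "u j * indicator {z j} (z j) \<le> emeasure p {z j}"
      unfolding mass by (rule member_le_sum) auto
    then show ?thesis by simp
  qed
  have meas: "f j \<in> borel_measurable p" for j
    unfolding f_def using sz by measurable
  moreover have "f j x = 0" if "x \<noteq> z j" for j x
    using that by (simp add: f_def)
  moreover have "AE x in p. (\<Sum>j\<in>UNIV. f j x) = 1"
  proof -
    \<comment> \<open>Pulled back along \<open>z\<close>, almost everywhere means at every index of
      positive mass, so only such \<open>k\<close> have to be checked.\<close>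
    have "(\<Sum>j\<in>UNIV. f j (z k)) = 1" if "0 < u k" for k
    proof -
      \<comment> \<open>Only indices with \<open>z j = z k\<close> contribute. They share one
        denominator, and their numerators add up to it by \<open>mass\<close>.\<close>
      have "(\<Sum>j\<in>UNIV. f j (z k)) = (\<Sum>j\<in>UNIV. u j * indicator {z k} (z j)) / emeasure p {z k}"
        by (auto simp: f_def indicator_def divide_ennreal_def sum_distrib_right intro!: sum.cong)
      also have "\<dots> = 1"
        using fin[of k] le[of k] that unfolding mass[symmetric] by (intro ennreal_divide_self) auto
      finally show ?thesis .
    qed
    moreover have "{x \<in> space (restrict_space borel S). (\<Sum>j\<in>UNIV. f j x) = 1} \<in> sets (restrict_space borel S)"
    proof -
      have "(\<lambda>x. \<Sum>j\<in>UNIV. f j x) \<in> borel_measurable p"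
        using meas by measurable
      then have "{x \<in> space p. (\<Sum>j\<in>UNIV. f j x) = 1} \<in> sets p"
        by measurable
      then show ?thesis
        by (simp add: p_def space_restrict_space)
    qed
    ultimately show ?thesis
      unfolding p_def weighted_empirical_def u_def
      by (subst AE_distr_iff[OF measurable_point_measure_UNIV[OF z]]) (auto simp: AE_point_measure)
  qed
  moreover have "(\<integral>\<^sup>+x. f j x \<partial>p) = u j" for j
  proof (cases "u j = 0")
    case False
    then have "emeasure p {z j} \<noteq> 0"
      using le[of j] by auto
    then show ?thesis
      using sz fin[of j] unfolding f_def
      by (subst nn_integral_cmult_indicator) (auto simp: ennreal_divide_times)
  qed (simp add: f_def)
  ultimately show ?thesis
    unfolding p_def u_def by blast
qed

text \<open>The cost is preserved exactly: under the integral the cost may be frozen at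
  \<open>(z j, w i)\<close> because \<open>f j\<close> and \<open>g i\<close> vanish elsewhere, and
  the products of these functions sum to 1 almost everywhere.\<close>

lemma transport_plan_of_coupling:
  fixes z :: "'m::finite \<Rightarrow> 'z::topological_space" and w :: "'n::finite \<Rightarrow> 'z"
    and \<theta> :: "real^'m" and \<eta> :: "real^'n"
  assumes z: "range z \<subseteq> S" and w: "range w \<subseteq> S" and \<theta>: "0 \<le> \<theta>" and \<eta>: "0 \<le> \<eta>"
    and singletons: "\<And>x. x \<in> S \<Longrightarrow> {x} \<in> sets (restrict_space borel S)"
    and c: "\<And>x y. x \<in> S \<Longrightarrow> y \<in> S \<Longrightarrow> 0 \<le> c x y"
    and \<pi>: "\<pi> \<in> couplings (weighted_empirical S \<theta> z) (weighted_empirical S \<eta> w)"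
  obtains P :: "real^'m^'n" where "0 \<le> P"
    and "P *v 1 = (1 / real CARD('n)) *\<^sub>R \<eta>"
    and "transpose P *v 1 = (1 / real CARD('m)) *\<^sub>R \<theta>"
    and "ennreal ((\<chi> i j. c (z j) (w i)) \<bullet> P) = (\<integral>\<^sup>+x. ennreal (c (fst x) (snd x)) \<partial>\<pi>)"
proof -
  define p q where "p = weighted_empirical S \<theta> z" and "q = weighted_empirical S \<eta> w"
  obtain f where f [measurable]: "\<And>j. f j \<in> borel_measurable p"
    and f0: "\<And>j x. x \<noteq> z j \<Longrightarrow> f j x = 0"
    and f1: "AE x in p. (\<Sum>j\<in>UNIV. f j x) = 1"
    and fint: "\<And>j. (\<integral>\<^sup>+x. f j x \<partial>p) = ennreal (\<theta> $ j / real CARD('m))"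
    using weighted_empirical_partition_of_unity[OF z singletons, of \<theta>, folded p_def] by blast
  obtain g where g [measurable]: "\<And>i. g i \<in> borel_measurable q"
    and g0: "\<And>i x. x \<noteq> w i \<Longrightarrow> g i x = 0"
    and g1: "AE x in q. (\<Sum>i\<in>UNIV. g i x) = 1"
    and gint: "\<And>i. (\<integral>\<^sup>+x. g i x \<partial>q) = ennreal (\<eta> $ i / real CARD('n))"
    using weighted_empirical_partition_of_unity[OF w singletons, of \<eta>, folded q_def] by blast
  have [measurable_cong]: "sets \<pi> = sets (p \<Otimes>\<^sub>M q)"
    and fst: "distr \<pi> p fst = p" and snd: "distr \<pi> q snd = q"
    using \<pi> by (auto simp: couplings_def p_def q_def)
  have fstm [measurable]: "fst \<in> measurable \<pi> p" and sndm [measurable]: "snd \<in> measurable \<pi> q"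
    by measurable
  \<comment> \<open>The marginal is the image of \<open>\<pi>\<close> under the projection, so its
    null sets pull back to null sets of \<open>\<pi>\<close>.\<close>
  have f1': "AE x in \<pi>. (\<Sum>j\<in>UNIV. f j (fst x)) = 1"
    by (rule AE_distrD[OF fstm, unfolded fst, OF f1])
  have g1': "AE x in \<pi>. (\<Sum>i\<in>UNIV. g i (snd x)) = 1"
    by (rule AE_distrD[OF sndm, unfolded snd, OF g1])
  \<comment> \<open>Working in \<open>ennreal\<close> first lets sums and integrals be exchanged
    freely; finiteness is read off afterwards from the row sums.\<close>
  define Q where "Q i j = (\<integral>\<^sup>+x. f j (fst x) * g i (snd x) \<partial>\<pi>)" for i j
  have col: "(\<Sum>i\<in>UNIV. Q i j) = ennreal (\<theta> $ j / real CARD('m))" for j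
  proof -
    \<comment> \<open>Summing over \<open>i\<close> removes the second coordinate through
      \<open>g1'\<close>, and what remains is an integral over the first marginal.\<close>
    have "(\<Sum>i\<in>UNIV. Q i j) = (\<integral>\<^sup>+x. f j (fst x) * (\<Sum>i\<in>UNIV. g i (snd x)) \<partial>\<pi>)"
      unfolding Q_def sum_distrib_left by (subst nn_integral_sum) auto
    also have "\<dots> = (\<integral>\<^sup>+x. f j (fst x) \<partial>\<pi>)"
      by (rule nn_integral_cong_AE, use g1' in eventually_elim) simp
    also have "\<dots> = (\<integral>\<^sup>+x. f j x \<partial>distr \<pi> p fst)"
      by (subst nn_integral_distr) auto
    finally show ?thesis
      by (simp add: fst fint)
  qed
  have row: "(\<Sum>j\<in>UNIV. Q i j) = ennreal (\<eta> $ i / real CARD('n))" for i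
  proof -
    have "(\<Sum>j\<in>UNIV. Q i j) = (\<integral>\<^sup>+x. (\<Sum>j\<in>UNIV. f j (fst x)) * g i (snd x) \<partial>\<pi>)"
      unfolding Q_def sum_distrib_right by (subst nn_integral_sum) auto
    also have "\<dots> = (\<integral>\<^sup>+x. g i (snd x) \<partial>\<pi>)"
      by (rule nn_integral_cong_AE, use f1' in eventually_elim) simp
    also have "\<dots> = (\<integral>\<^sup>+x. g i x \<partial>distr \<pi> q snd)"
      by (subst nn_integral_distr) auto
    finally show ?thesis
      by (simp add: snd gint)
  qed
  define P :: "real^'m^'n" where "P = (\<chi> i j. enn2real (Q i j))"
  \<comment> \<open>Each entry is bounded by its row sum, a real number, so passing to
    \<open>enn2real\<close> loses nothing.\<close>
  have "Q i j < top" for i j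
  proof -
    have "Q i j \<le> (\<Sum>j\<in>UNIV. Q i j)"
      by (rule member_le_sum) auto
    then show ?thesis
      unfolding row by (rule le_less_trans) simp
  qed
  then have Q: "Q i j = ennreal (P $ i $ j)" for i j
    by (simp add: P_def)
  have nn: "0 \<le> P $ i $ j" for i j
    by (simp add: P_def)
  have cost: "(\<Sum>i\<in>UNIV. \<Sum>j\<in>UNIV. ennreal (c (z j) (w i)) * Q i j) =
      (\<integral>\<^sup>+x. ennreal (c (fst x) (snd x)) \<partial>\<pi>)"
  proof -
    have "(\<Sum>i\<in>UNIV. \<Sum>j\<in>UNIV. ennreal (c (z j) (w i)) * Q i j) =
        (\<integral>\<^sup>+x. (\<Sum>i\<in>UNIV. \<Sum>j\<in>UNIV. ennreal (c (z j) (w i)) * (f j (fst x) * g i (snd x))) \<partial>\<pi>)"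
      unfolding Q_def by (simp add: nn_integral_sum nn_integral_cmult)
    \<comment> \<open>This replacement holds at every \<open>x\<close>: a summand is 0 unless
      \<open>fst x = z j\<close> and \<open>snd x = w i\<close>, where the two costs
      coincide.\<close>
    also have "\<dots> = (\<integral>\<^sup>+x. (\<Sum>i\<in>UNIV. \<Sum>j\<in>UNIV.
        ennreal (c (fst x) (snd x)) * (f j (fst x) * g i (snd x))) \<partial>\<pi>)"
      using f0 g0 by (intro nn_integral_cong sum.cong refl) (metis mult_zero_left mult_zero_right)
    also have "\<dots> = (\<integral>\<^sup>+x. ennreal (c (fst x) (snd x)) *
        ((\<Sum>i\<in>UNIV. g i (snd x)) * (\<Sum>j\<in>UNIV. f j (fst x))) \<partial>\<pi>)"
      by (simp add: sum_product sum_distrib_left mult_ac)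
    also have "\<dots> = (\<integral>\<^sup>+x. ennreal (c (fst x) (snd x)) \<partial>\<pi>)"
      by (rule nn_integral_cong_AE, use f1' g1' in eventually_elim) simp
    finally show ?thesis .
  qed
  have "0 \<le> P"
    using nn by (simp add: less_eq_vec_def)
  moreover have "P *v 1 = (1 / real CARD('n)) *\<^sub>R \<eta>"
    using row nn \<eta>
    by (simp add: vec_eq_iff matrix_vector_mult_def Q sum_nonneg less_eq_vec_def)
  moreover have "transpose P *v 1 = (1 / real CARD('m)) *\<^sub>R \<theta>"
    using col nn \<theta>
    by (simp add: vec_eq_iff matrix_vector_mult_def transpose_def Q sum_nonneg less_eq_vec_def)
  moreover have "ennreal ((\<chi> i j. c (z j) (w i)) \<bullet> P) = (\<integral>\<^sup>+x. ennreal (c (fst x) (snd x)) \<partial>\<pi>)"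
  proof -
    have "0 \<le> c (z j) (w i)" for i j
      using c z w by blast
    then show ?thesis
      unfolding cost[symmetric]
      by (simp add: transport_plan_cost Q nn sum_nonneg flip: ennreal_mult sum_ennreal)
  qed
  ultimately show ?thesis
    by (rule that)
qed

section \<open>Feasible matrices and feasible weights\<close>

lemma singleton_sets_restrict_borel:
  fixes x :: "'z::t1_space"
  assumes "x \<in> S"
  shows "{x} \<in> sets (restrict_space borel S)"
  using assms by (auto simp: sets_restrict_space intro!: image_eqI[where x = "{x}"])

text \<open>The \<open>n\<close> rows sum to \<open>1/n\<close> each, so the total mass is 1 and the
  column sums scaled by \<open>m\<close> have sum \<open>m\<close>. The inequalities are homogeneous
  and survive the scaling.\<close>

lemma lp_feasible_weights:
  fixes P :: "real^'m::finite^'n::finite"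
  assumes "P \<in> lp_feasible R A"
  shows "real CARD('m) *\<^sub>R (transpose P *v 1) \<in> weight_simplex"
    and "\<forall>r\<in>R. 0 \<le> A r \<bullet> (real CARD('m) *\<^sub>R (transpose P *v 1))"
proof -
  have rows: "P *v 1 = (1 / real CARD('n)) *\<^sub>R 1" and P: "0 \<le> P"
    and A: "\<forall>r\<in>R. 0 \<le> A r \<bullet> (transpose P *v 1)"
    using assms by (auto simp: lp_feasible_def)
  have "(\<Sum>j\<in>UNIV. P $ i $ j) = 1 / real CARD('n)" for i
    using arg_cong[OF rows, of "\<lambda>v. v $ i"] by (simp add: matrix_vector_mult_def)
  then have "(\<Sum>j\<in>UNIV. \<Sum>i\<in>UNIV. P $ i $ j) = 1"
    by (subst sum.swap) simp
  moreover have "0 \<le> P $ i $ j" for i j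
    using P by (simp add: less_eq_vec_def)
  ultimately show "real CARD('m) *\<^sub>R (transpose P *v 1) \<in> weight_simplex"
    by (simp add: weight_simplex_def less_eq_vec_def matrix_vector_mult_def transpose_def sum_nonneg
        flip: sum_distrib_left)
  show "\<forall>r\<in>R. 0 \<le> A r \<bullet> (real CARD('m) *\<^sub>R (transpose P *v 1))"
    using A by simp
qed

section \<open>Equivalence of the coreset problem and the linear program\<close>

theorem mainTheorem1:
  fixes \<D> :: "'d::euclidean_space set"
    and \<X> :: "'x::euclidean_space set"
    and \<Y> :: "'y::euclidean_space set"
    and Z :: "'n::finite \<Rightarrow> 'd \<times> 'x \<times> 'y"
    and Dh :: "'m::finite \<Rightarrow> 'd"
    and Yh :: "'m \<Rightarrow> 'y"
    and pT :: "'y pmf"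
    and \<epsilon> :: real
    and c :: "'d \<times> 'x \<times> 'y \<Rightarrow> 'd \<times> 'x \<times> 'y \<Rightarrow> real"
  defines "\<Z> \<equiv> \<D> \<times> \<X> \<times> \<Y>"
    and "A \<equiv> fairness_matrix pT \<epsilon> Dh Yh"
    and "R \<equiv> fairness_rows \<D> \<Y>"
    and "C \<equiv> \<lambda>Xh. cost_matrix c Z (coreset_point Dh Yh Xh)"
    and "feasible \<equiv> coreset_feasible \<D> \<X> \<Y> pT \<epsilon> Dh Yh"
    and "objective \<equiv> coreset_objective \<D> \<X> \<Y> c Z Dh Yh"
  assumes "finite \<D>" and "finite \<Y>"
    and "range Z \<subseteq> \<Z>"
    and "range Dh \<subseteq> \<D>" and "range Yh \<subseteq> \<Y>"
    and "set_pmf pT \<subseteq> \<Y>" and "\<And>y. y \<in> \<Y> \<Longrightarrow> 0 < pmf pT y"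
    and "0 \<le> \<epsilon>"
    and "\<And>z z'. z \<in> \<Z> \<Longrightarrow> z' \<in> \<Z> \<Longrightarrow> 0 \<le> c z z'"
    and "\<And>z z'. z \<in> \<Z> \<Longrightarrow> z' \<in> \<Z> \<Longrightarrow> c z z' = c z' z"
  shows
    "(card R = 2 * card \<Y> * card \<D> \<and>
      (\<forall>\<theta>\<in>weight_simplex. \<forall>Xh. range Xh \<subseteq> \<X> \<longrightarrow>
        (fairness_constraints \<D> \<X> \<Y> pT \<epsilon> Dh Yh \<theta> Xh \<longleftrightarrow>
          (\<forall>d\<in>\<D>. \<forall>y\<in>\<Y>.
            (1 - \<epsilon>) * pmf pT y * (\<Sum>i | Dh i = d. \<theta> $ i) \<le> (\<Sum>i | Dh i = d \<and> Yh i = y. \<theta> $ i) \<and>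
            (\<Sum>i | Dh i = d \<and> Yh i = y. \<theta> $ i) \<le> (1 + \<epsilon>) * pmf pT y * (\<Sum>i | Dh i = d. \<theta> $ i))) \<and>
        (fairness_constraints \<D> \<X> \<Y> pT \<epsilon> Dh Yh \<theta> Xh \<longleftrightarrow> (\<forall>r\<in>R. 0 \<le> A r \<bullet> \<theta>)))) \<and>
     ((INF q\<in>feasible. objective q) = (INF Xh\<in>{Xh. range Xh \<subseteq> \<X>}. lp_value R A (C Xh)) \<and>
      (\<forall>Xstar Pstar.
        is_arg_min (\<lambda>Xh. lp_value R A (C Xh)) (\<lambda>Xh. range Xh \<subseteq> \<X>) Xstar \<longrightarrow>
        is_arg_min (\<lambda>P. C Xstar \<bullet> P) (\<lambda>P. P \<in> lp_feasible R A) Pstar \<longrightarrow>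
        is_arg_min objective (\<lambda>q. q \<in> feasible)
          (real CARD('m) *\<^sub>R (transpose Pstar *v 1), Xstar)))"
proof -
  have zh: "range (coreset_point Dh Yh Xh) \<subseteq> \<Z>" if "range Xh \<subseteq> \<X>" for Xh
    using that \<open>range Dh \<subseteq> \<D>\<close> \<open>range Yh \<subseteq> \<Y>\<close> by (auto simp: \<Z>_def coreset_point_def)
  have fair: "fairness_constraints \<D> \<X> \<Y> pT \<epsilon> Dh Yh \<theta> Xh \<longleftrightarrow>
      (\<forall>d\<in>\<D>. \<forall>y\<in>\<Y>.
        (1 - \<epsilon>) * pmf pT y * (\<Sum>i | Dh i = d. \<theta> $ i) \<le> (\<Sum>i | Dh i = d \<and> Yh i = y. \<theta> $ i) \<and>
        (\<Sum>i | Dh i = d \<and> Yh i = y. \<theta> $ i) \<le> (1 + \<epsilon>) * pmf pT y * (\<Sum>i | Dh i = d. \<theta> $ i))"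
    if "\<theta> \<in> weight_simplex" and "range Xh \<subseteq> \<X>" for \<theta> Xh
    using fairness_constraints_iff[OF zh[OF that(2), unfolded \<Z>_def]] that(1) assms(13)
    by (auto simp: weight_simplex_def)
  have rows: "fairness_constraints \<D> \<X> \<Y> pT \<epsilon> Dh Yh \<theta> Xh \<longleftrightarrow> (\<forall>r\<in>R. 0 \<le> A r \<bullet> \<theta>)"
    if "\<theta> \<in> weight_simplex" and "range Xh \<subseteq> \<X>" for \<theta> Xh
    unfolding fair[OF that] R_def A_def fairness_rows_nonneg_iff ..
  \<comment> \<open>The cost matrix puts the data point first, whereas the transport problem has the
    coreset measure as first marginal; symmetry of \<open>c\<close> reconciles the two.\<close>
  have C: "C Xh = (\<chi> i j. c (coreset_point Dh Yh Xh j) (Z i))"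
    and c: "0 \<le> c (coreset_point Dh Yh Xh j) (Z i)" if "range Xh \<subseteq> \<X>" for Xh i j
  proof -
    have *: "coreset_point Dh Yh Xh j \<in> \<Z>" "Z i \<in> \<Z>" for i j
      using zh[OF that] \<open>range Z \<subseteq> \<Z>\<close> by auto
    show "0 \<le> c (coreset_point Dh Yh Xh j) (Z i)"
      by (intro assms *)
    show "C Xh = (\<chi> i j. c (coreset_point Dh Yh Xh j) (Z i))"
      unfolding C_def cost_matrix_def by (simp add: vec_eq_iff assms(16) *)
  qed
  \<comment> \<open>The weights are chosen so that the column condition of a transport matrix holds
    for \<open>P\<close> by construction.\<close>
  have upper: "(real CARD('m) *\<^sub>R (transpose P *v 1), Xh) \<in> feasible \<and>
      objective (real CARD('m) *\<^sub>R (transpose P *v 1), Xh) \<le> ereal (C Xh \<bullet> P)"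
    if "range Xh \<subseteq> \<X>" and "P \<in> lp_feasible R A" for Xh P
  proof
    let ?\<theta> = "real CARD('m) *\<^sub>R (transpose P *v 1)"
    show "(?\<theta>, Xh) \<in> feasible"
      using lp_feasible_weights[OF that(2)] rows that(1)
      by (auto simp: feasible_def coreset_feasible_def)
    have P: "0 \<le> P" "P *v 1 = (1 / real CARD('n)) *\<^sub>R 1"
      using that(2) by (auto simp: lp_feasible_def)
    have "wasserstein c (weighted_empirical \<Z> ?\<theta> (coreset_point Dh Yh Xh)) (weighted_empirical \<Z> 1 Z)
        \<le> ennreal (C Xh \<bullet> P)"
      unfolding C[OF that(1)]
      using zh[OF that(1)] \<open>range Z \<subseteq> \<Z>\<close> P assms(15) singleton_sets_restrict_borel
      by (intro wasserstein_le_transport_plan) auto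
    moreover have "0 \<le> C Xh \<bullet> P"
      using P(1) c[OF that(1)] by (auto simp: C[OF that(1)] transport_plan_cost less_eq_vec_def
          intro!: sum_nonneg mult_nonneg_nonneg)
    ultimately show "objective (?\<theta>, Xh) \<le> ereal (C Xh \<bullet> P)"
      unfolding objective_def coreset_objective_def \<Z>_def[symmetric]
      by (simp add: less_eq_ennreal.rep_eq enn2ereal_ennreal)
  qed
  have lower: "lp_value R A (C Xh) \<le> objective (\<theta>, Xh)" and X: "range Xh \<subseteq> \<X>"
    if "(\<theta>, Xh) \<in> feasible" for \<theta> Xh
  proof -
    from that have \<theta>: "\<theta> \<in> weight_simplex" and X: "range Xh \<subseteq> \<X>"
      and "fairness_constraints \<D> \<X> \<Y> pT \<epsilon> Dh Yh \<theta> Xh"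
      by (auto simp: feasible_def coreset_feasible_def)
    then have A: "\<forall>r\<in>R. 0 \<le> A r \<bullet> \<theta>"
      using rows by blast
    show "range Xh \<subseteq> \<X>"
      by fact
    have \<theta>0: "0 \<le> \<theta>" and one0: "0 \<le> (1 :: real^'n)"
      using \<theta> by (auto simp: weight_simplex_def less_eq_vec_def)
    \<comment> \<open>The Wasserstein infimum lives in \<open>ennreal\<close>, so the comparison is
      made there. Returning to \<open>ereal\<close> requires a nonnegative \<open>lp_value\<close>,
      since \<open>e2ennreal\<close> truncates.\<close>
    have "e2ennreal (lp_value R A (C Xh)) \<le>
        wasserstein c (weighted_empirical \<Z> \<theta> (coreset_point Dh Yh Xh)) (weighted_empirical \<Z> 1 Z)"
      unfolding wasserstein_def
    proof (rule INF_greatest)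
      fix \<pi> assume \<pi>: "\<pi> \<in> couplings (weighted_empirical \<Z> \<theta> (coreset_point Dh Yh Xh)) (weighted_empirical \<Z> 1 Z)"
      obtain P :: "real^'m^'n" where P: "0 \<le> P" "P *v 1 = (1 / real CARD('n)) *\<^sub>R 1"
        "transpose P *v 1 = (1 / real CARD('m)) *\<^sub>R \<theta>"
        and cost: "ennreal (C Xh \<bullet> P) = (\<integral>\<^sup>+x. ennreal (c (fst x) (snd x)) \<partial>\<pi>)"
        unfolding C[OF X]
        using transport_plan_of_coupling[where c = c, OF zh[OF X] \<open>range Z \<subseteq> \<Z>\<close> \<theta>0 one0
            singleton_sets_restrict_borel assms(15) \<pi>] by blast
      \<comment> \<open>The column sums are \<open>\<theta>\<close> divided by \<open>m\<close>, and
        homogeneity again transfers the inequalities from \<open>A\<close>.\<close>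
      have "P \<in> lp_feasible R A"
        using P A by (auto simp: lp_feasible_def)
      then have "lp_value R A (C Xh) \<le> ereal (C Xh \<bullet> P)"
        unfolding lp_value_def by (rule INF_lower)
      from e2ennreal_mono[OF this]
      show "e2ennreal (lp_value R A (C Xh)) \<le> (\<integral>\<^sup>+x. ennreal (c (fst x) (snd x)) \<partial>\<pi>)"
        unfolding e2ennreal_ereal cost .
    qed
    moreover have "0 \<le> lp_value R A (C Xh)"
      unfolding lp_value_def
      using c[OF X] by (auto simp: C[OF X] transport_plan_cost less_eq_vec_def lp_feasible_def
          intro!: INF_greatest sum_nonneg mult_nonneg_nonneg)
    ultimately show "lp_value R A (C Xh) \<le> objective (\<theta>, Xh)"
      unfolding objective_def coreset_objective_def \<Z>_def[symmetric]
      by (simp add: less_eq_ennreal.rep_eq enn2ereal_e2ennreal)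
  qed
  \<comment> \<open>Comparing single candidates suffices: neither infimum has to be attained, and
    empty feasible sets are covered by the value \<open>\<infinity>\<close>.\<close>
  have "(INF q\<in>feasible. objective q) = (INF Xh\<in>{Xh. range Xh \<subseteq> \<X>}. lp_value R A (C Xh))"
  proof (rule antisym)
    show "(INF q\<in>feasible. objective q) \<le> (INF Xh\<in>{Xh. range Xh \<subseteq> \<X>}. lp_value R A (C Xh))"
      unfolding lp_value_def
      by (intro INF_greatest) (metis INF_lower2 mem_Collect_eq upper)
    show "(INF Xh\<in>{Xh. range Xh \<subseteq> \<X>}. lp_value R A (C Xh)) \<le> (INF q\<in>feasible. objective q)"
      by (intro INF_greatest) (metis INF_lower2 mem_Collect_eq lower X surj_pair)
  qed
  moreover have "is_arg_min objective (\<lambda>q. q \<in> feasible)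
      (real CARD('m) *\<^sub>R (transpose Pstar *v 1), Xstar)"
    if Xs: "is_arg_min (\<lambda>Xh. lp_value R A (C Xh)) (\<lambda>Xh. range Xh \<subseteq> \<X>) Xstar"
      and Ps: "is_arg_min (\<lambda>P. C Xstar \<bullet> P) (\<lambda>P. P \<in> lp_feasible R A) Pstar" for Xstar Pstar
  proof -
    have Xstar: "range Xstar \<subseteq> \<X>" and Pstar: "Pstar \<in> lp_feasible R A"
      using Xs Ps by (auto simp: is_arg_min_def)
    \<comment> \<open>The chain runs from \<open>upper\<close> at the optimal matrix through
      optimality of \<open>Pstar\<close> and then of \<open>Xstar\<close> to \<open>lower\<close> at
      the competitor.\<close>
    have "objective (real CARD('m) *\<^sub>R (transpose Pstar *v 1), Xstar) \<le> objective (\<theta>, Xh)"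
      if "(\<theta>, Xh) \<in> feasible" for \<theta> Xh
    proof -
      have "objective (real CARD('m) *\<^sub>R (transpose Pstar *v 1), Xstar) \<le> ereal (C Xstar \<bullet> Pstar)"
        using upper[OF Xstar Pstar] by simp
      also have "\<dots> \<le> lp_value R A (C Xstar)"
        unfolding lp_value_def using Ps by (auto simp: is_arg_min_def not_less intro!: INF_greatest)
      also have "\<dots> \<le> lp_value R A (C Xh)"
        using Xs X[OF that] by (auto simp: is_arg_min_def not_less)
      also have "\<dots> \<le> objective (\<theta>, Xh)"
        by (rule lower[OF that])
      finally show ?thesis .
    qed
    then show ?thesis
      using upper[OF Xstar Pstar] by (force simp: is_arg_min_def not_less)
  qed
  ultimately show ?thesis
    by (intro conjI ballI allI impI card_fairness_rows[of \<D> \<Y>, folded R_def] fair rows)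
qed

end
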